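(* Let $X$ be a path connected topological space and $x\in X$. If $f,g$ are paths in $X$ with $f(0)=g(0)=x$, $f(1)=g(1)$ and $f\xrightarrow{close} g$ rel $\dot I$, then $[f*g^{-1}]\in\pi_1^{qs}(X,x)$. Moreover, for every subgroup $H$ of $\pi_1(X,x)$, $$\pi_H^{qs}(X,x)=H\,\pi_1^{qs}(X,x).$$
   Context: All spaces are assumed path connected. $I=[0,1]$, $\dot I=\{0,1\}$; $\simeq$ rel $\dot I$ denotes homotopy of paths relative to endpoints, and $[f]$ is the homotopy class of a path $f$ rel $\dot I$. $*$ is concatenation of paths, $g^{-1}$ is the reverse path, $c_x$ is the constant path at $x$. Closeness: let $f,g:I\to X$ be paths with $f(0)=g(0)$ and $f(1)=g(1)$. We say $f$ is homotopically close to $g$ rel $\dot I$ (written $f\xrightarrow{close} g$ rel $\dot I$) if for every partition $0=t_0<t_1<\cdots<t_n=1$ and every sequence of open sets $U_1,\ldots,U_n$ of $X$ with $g([t_{i-1},t_i])\subset U_i$ for all $i$, there is a path $\gamma$ with $\gamma([t_{i-1},t_i])\subset U_i$ for $1\le i\le n$, $\gamma(t_i)=g(t_i)$ for $0\le i\le n$, and $\gamma\simeq f$ rel $\dot I$. For a subset $H\subseteq\pi_1(X,x)$, $\pi_H^{qs}(X,x)=\{[f]\in\pi_1(X,x) : f\xrightarrow{close} h \text{ rel } \dot I \text{ for some loop } h \text{ at } x \text{ with } [h]\in H\}$. For $H=\{[c_x]\}$ the trivial subgroup, write $\pi_1^{qs}(X,x)$. For subsets $A,B$ of a group, $AB=\{ab: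 a\in A,b\in B\}$. *)

theory Defs
  imports "HOL-Analysis.Analysis" "HOL-Algebra.Coset"
begin

text \<open>
  A topological space is a set \<open>X\<close> in a type of class \<^class>\<open>topological_space\<close>, with the subspace
  topology; \<^prop>\<open>X = UNIV\<close> is the case of the whole type.  Library paths are functions on all
  of the reals of which only the restriction to the unit interval matters.
\<close>

definition path_class ::
    "'a::topological_space set \<Rightarrow> (real \<Rightarrow> 'a) \<Rightarrow> (real \<Rightarrow> 'a) set"
  where "path_class X f = {g. homotopic_paths X f g}"

definition loop_at :: "'a::topological_space set \<Rightarrow> 'a \<Rightarrow> (real \<Rightarrow> 'a) \<Rightarrow> bool"
  where "loop_at X x f \<longleftrightarrow>
    path f \<and> path_image f \<subseteq> X \<and> pathstart f = x \<and> pathfinish f = x"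

text \<open>
  The product is the class of \<open>f +++ g\<close> for any representatives \<open>f\<close>, \<open>g\<close>; see
  \<open>mult_fundamental_group\<close> below.
\<close>

definition fundamental_group ::
    "'a::topological_space set \<Rightarrow> 'a \<Rightarrow> (real \<Rightarrow> 'a) set monoid"
  where "fundamental_group X x =
    \<lparr>carrier = path_class X ` {f. loop_at X x f},
     mult = (\<lambda>A B. \<Union>f\<in>A. \<Union>g\<in>B. path_class X (f +++ g)),
     one = path_class X (\<lambda>_. x)\<rparr>"

definition homotopically_close ::
    "'a::topological_space set \<Rightarrow> (real \<Rightarrow> 'a) \<Rightarrow> (real \<Rightarrow> 'a) \<Rightarrow> bool"
  where "homotopically_close X f g \<longleftrightarrow>
    path f \<and> path_image f \<subseteq> X \<and> path g \<and> path_image g \<subseteq> X \<and>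
    pathstart f = pathstart g \<and> pathfinish f = pathfinish g \<and>
    (\<forall>(n::nat) (t::nat \<Rightarrow> real) (U::nat \<Rightarrow> 'a set).
      t 0 = 0 \<and> t n = 1 \<and> (\<forall>i\<in>{1..n}. t (i - 1) < t i) \<and>
      (\<forall>i\<in>{1..n}. openin (top_of_set X) (U i) \<and> g ` {t (i - 1)..t i} \<subseteq> U i)
      \<longrightarrow> (\<exists>\<gamma>. path \<gamma> \<and> path_image \<gamma> \<subseteq> X \<and>
            (\<forall>i\<in>{1..n}. \<gamma> ` {t (i - 1)..t i} \<subseteq> U i) \<and>
            (\<forall>i\<in>{0..n}. \<gamma> (t i) = g (t i)) \<and>
            homotopic_paths X \<gamma> f))"

definition pi_qs ::
    "'a::topological_space set \<Rightarrow> 'a \<Rightarrow> (real \<Rightarrow> 'a) set set \<Rightarrow> (real \<Rightarrow> 'a) set set"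
  where "pi_qs X x H =
    {path_class X f | f. loop_at X x f \<and>
       (\<exists>h. loop_at X x h \<and> path_class X h \<in> H \<and> homotopically_close X f h)}"

definition pi1_qs :: "'a::topological_space set \<Rightarrow> 'a \<Rightarrow> (real \<Rightarrow> 'a) set set"
  where "pi1_qs X x = pi_qs X x {path_class X (\<lambda>_. x)}"


lemma path_class_eq_iff:
  assumes "path f" "path_image f \<subseteq> X"
  shows "path_class X f = path_class X g \<longleftrightarrow> homotopic_paths X f g"
proof
  assume "path_class X f = path_class X g"
  moreover have "f \<in> path_class X f"
    using assms by (simp add: path_class_def)
  ultimately show "homotopic_paths X f g"
    by (simp add: path_class_def homotopic_paths_sym)
next
  assume "homotopic_paths X f g"
  then show "path_class X f = path_class X g"
    unfolding path_class_def by (blast intro: homotopic_paths_sym homotopic_paths_trans)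
qed

lemma loop_at_const: "x \<in> X \<Longrightarrow> loop_at X x (\<lambda>_. x)"
  by (auto simp: loop_at_def path_def path_image_def pathstart_def pathfinish_def)

lemma loop_at_join: "loop_at X x f \<Longrightarrow> loop_at X x g \<Longrightarrow> loop_at X x (f +++ g)"
  by (auto simp: loop_at_def path_image_join)

lemma loop_at_reversepath: "loop_at X x f \<Longrightarrow> loop_at X x (reversepath f)"
  by (auto simp: loop_at_def)

lemma mult_fundamental_group:
  assumes "loop_at X x f" "loop_at X x g"
  shows "path_class X f \<otimes>\<^bsub>fundamental_group X x\<^esub> path_class X g = path_class X (f +++ g)"
proof -
  have "path_class X (f' +++ g') = path_class X (f +++ g)"
    if "homotopic_paths X f f'" "homotopic_paths X g g'" for f' g'
  proof -
    have "homotopic_paths X (f +++ g) (f' +++ g')"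
      using assms that by (intro homotopic_paths_join) (auto simp: loop_at_def)
    then show ?thesis
      using path_class_eq_iff[of "f +++ g" X "f' +++ g'"] loop_at_join[OF assms]
      by (simp add: loop_at_def)
  qed
  then have "(\<Union>f'\<in>path_class X f. \<Union>g'\<in>path_class X g. path_class X (f' +++ g')) =
      (\<Union>f'\<in>path_class X f. \<Union>g'\<in>path_class X g. path_class X (f +++ g))"
    by (intro SUP_cong refl) (simp add: path_class_def)
  moreover have "path_class X f \<noteq> {}" "path_class X g \<noteq> {}"
    using assms homotopic_paths_refl unfolding loop_at_def path_class_def by blast+
  ultimately show ?thesis
    by (simp add: fundamental_group_def)
qed

text \<open>
  The library states the unit and inverse laws for homotopies of paths only in normed spaces, since
  its constant paths are line segments.
\<close>

lemma homotopic_paths_const_left: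
  assumes "path p" "path_image p \<subseteq> X" "pathstart p = x"
  shows "homotopic_paths X ((\<lambda>_. x) +++ p) p"
proof (rule homotopic_paths_sym)
  have c: "continuous_on {0..1} (\<lambda>t::real. if t \<le> 1/2 then 0 else 2 * t - 1)"
    unfolding split_01
    by (rule continuous_on_cases continuous_intros | force)+
  show "homotopic_paths X p ((\<lambda>_. x) +++ p)"
    by (rule homotopic_paths_reparametrize[OF assms(1,2) c])
      (use assms in \<open>auto simp: joinpaths_def pathstart_def\<close>)
qed

lemma homotopic_paths_reversepath_left:
  assumes "path p" "path_image p \<subseteq> X" "pathfinish p = x"
  shows "homotopic_paths X (reversepath p +++ p) (\<lambda>_. x)"
proof -
  define k where "k = (\<lambda>(s::real, t::real). 1 - (1 - s) * (1 - \<bar>2 * t - 1\<bar>))"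
  have k: "k z \<in> {0..1}" if "z \<in> {0..1} \<times> {0..1}" for z
  proof -
    obtain u v where z: "z = (u, v)" "0 \<le> u" "u \<le> 1" "0 \<le> v" "v \<le> 1"
      using \<open>z \<in> {0..1} \<times> {0..1}\<close> by (cases z) simp
    then have "0 \<le> 1 - \<bar>2 * v - 1\<bar>" "1 - \<bar>2 * v - 1\<bar> \<le> 1"
      by linarith+
    then have "0 \<le> (1 - u) * (1 - \<bar>2 * v - 1\<bar>)" "(1 - u) * (1 - \<bar>2 * v - 1\<bar>) \<le> 1"
      using z by (simp_all add: mult_le_one)
    then show ?thesis
      by (simp add: z k_def)
  qed
  have ck: "continuous_on ({0..1} \<times> {0..1}) k"
    unfolding k_def case_prod_unfold by (intro continuous_intros)
  show ?thesis
    unfolding homotopic_paths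
  proof (intro exI[of _ "p \<circ> k"] conjI ballI)
    have "k ` ({0..1} \<times> {0..1}) \<subseteq> {0..1}"
      using k by (rule image_subsetI)
    then show "continuous_on ({0..1} \<times> {0..1}) (p \<circ> k)"
      using assms(1) ck continuous_on_compose continuous_on_subset unfolding path_def by blast
    show "p \<circ> k \<in> {0..1} \<times> {0..1} \<rightarrow> X"
      using k assms(2) unfolding path_image_def by fastforce
    show "(p \<circ> k) (0, t) = (reversepath p +++ p) t" for t
      by (simp add: k_def joinpaths_def reversepath_def)
    show "(p \<circ> k) (1, t) = x" for t
      using assms(3) by (simp add: k_def pathfinish_def)
    show "pathstart ((p \<circ> k) \<circ> Pair s) = pathstart (reversepath p +++ p)"
        "pathfinish ((p \<circ> k) \<circ> Pair s) = pathfinish (reversepath p +++ p)" for s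
      using assms(3) by (simp_all add: k_def pathstart_def pathfinish_def joinpaths_def reversepath_def)
  qed
qed

lemma group_fundamental_group:
  assumes "x \<in> X"
  shows "group (fundamental_group X x)"
proof -
  let ?G = "fundamental_group X x"
  have carr: "A \<in> carrier ?G \<longleftrightarrow> (\<exists>f. loop_at X x f \<and> A = path_class X f)" for A
    by (auto simp: fundamental_group_def)
  have one: "\<one>\<^bsub>?G\<^esub> = path_class X (\<lambda>_. x)"
    by (simp add: fundamental_group_def)
  show ?thesis
  proof (rule groupI)
    show "A \<otimes>\<^bsub>?G\<^esub> B \<in> carrier ?G" if "A \<in> carrier ?G" "B \<in> carrier ?G" for A B
      using that by (metis carr loop_at_join mult_fundamental_group)
    show "\<one>\<^bsub>?G\<^esub> \<in> carrier ?G"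
      using assms carr loop_at_const one by blast
    show "A \<otimes>\<^bsub>?G\<^esub> B \<otimes>\<^bsub>?G\<^esub> C = A \<otimes>\<^bsub>?G\<^esub> (B \<otimes>\<^bsub>?G\<^esub> C)"
      if ABC: "A \<in> carrier ?G" "B \<in> carrier ?G" "C \<in> carrier ?G" for A B C
    proof -
      obtain f g h where fgh: "loop_at X x f" "loop_at X x g" "loop_at X x h"
        and "A = path_class X f" "B = path_class X g" "C = path_class X h"
        using ABC carr by metis
      moreover have "homotopic_paths X (f +++ (g +++ h)) ((f +++ g) +++ h)"
        using fgh by (intro homotopic_paths_assoc) (auto simp: loop_at_def)
      then have "path_class X (f +++ (g +++ h)) = path_class X ((f +++ g) +++ h)"
        by (metis path_class_eq_iff homotopic_paths_imp_path homotopic_paths_imp_subset)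
      ultimately show ?thesis
        by (simp add: mult_fundamental_group loop_at_join)
    qed
    show "\<one>\<^bsub>?G\<^esub> \<otimes>\<^bsub>?G\<^esub> A = A" if A: "A \<in> carrier ?G" for A
    proof -
      obtain f where f: "loop_at X x f" "A = path_class X f"
        using A carr by metis
      then have "homotopic_paths X ((\<lambda>_. x) +++ f) f"
        by (intro homotopic_paths_const_left) (auto simp: loop_at_def)
      then have "path_class X ((\<lambda>_. x) +++ f) = path_class X f"
        by (metis path_class_eq_iff homotopic_paths_imp_path homotopic_paths_imp_subset)
      then show ?thesis
        using f assms by (simp add: one mult_fundamental_group loop_at_const)
    qed
    show "\<exists>B\<in>carrier ?G. B \<otimes>\<^bsub>?G\<^esub> A = \<one>\<^bsub>?G\<^esub>" if A: "A \<in> carrier ?G" for A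
    proof -
      obtain f where f: "loop_at X x f" "A = path_class X f"
        using A carr by metis
      then have "homotopic_paths X (reversepath f +++ f) (\<lambda>_. x)"
        by (intro homotopic_paths_reversepath_left) (auto simp: loop_at_def)
      then have "path_class X (reversepath f +++ f) = path_class X (\<lambda>_. x)"
        by (metis path_class_eq_iff homotopic_paths_imp_path homotopic_paths_imp_subset)
      then show ?thesis
        using f loop_at_reversepath[OF f(1)] carr
        by (metis one mult_fundamental_group)
    qed
  qed
qed

end

theory Submission
  imports Defs
begin

text \<open>
  Closeness survives translation: if \<open>f\<close> is homotopically close to \<open>g\<close>, then \<open>f +++ k\<close> is close to
  \<open>g +++ k\<close> and \<open>k +++ f\<close> is close to \<open>k +++ g\<close> for every composable path \<open>k\<close>
  (\<open>homotopically_close_join_right\<close>, \<open>homotopically_close_join_left\<close>), because a path that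
  approximates \<open>g\<close> can be run on one half of the unit interval and \<open>k\<close> itself on the other half.
  Closeness is not invariant under homotopy of the second path, and the set \<^const>\<open>pi1_qs\<close> is
  designed for this: its elements may be close to any null-homotopic loop, not just to the
  constant one.

  So if \<open>f\<close> is close to \<open>g\<close>, then \<open>f +++ reversepath g\<close> is close to the null-homotopic loop
  \<open>g +++ reversepath g\<close>, which is the first claim.  In the same way, if \<open>f\<close> is close to a loop \<open>h\<close>
  with class in \<open>H\<close>, then \<open>reversepath h +++ f\<close> is close to \<open>reversepath h +++ h\<close>, and the
  factorisation \<open>[f] = [h] [reversepath h +++ f]\<close> shows that \<open>[f]\<close> lies in the product set.
  Conversely, if \<open>f\<close> is close to a null-homotopic loop \<open>c\<close> and \<open>[h]\<close> is in \<open>H\<close>, then \<open>h +++ f\<close> is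
  close to \<open>h +++ c\<close>, whose class is \<open>[h]\<close>.
\<close>

lemma homotopically_closeD:
  fixes t :: "nat \<Rightarrow> real"
  assumes "homotopically_close X f g"
    and "t 0 = 0" "t n = 1" "\<And>i. i \<in> {1..n} \<Longrightarrow> t (i - 1) < t i"
    and "\<And>i. i \<in> {1..n} \<Longrightarrow> openin (top_of_set X) (U i)"
    and "\<And>i. i \<in> {1..n} \<Longrightarrow> g ` {t (i - 1)..t i} \<subseteq> U i"
  obtains \<gamma> where "path \<gamma>" "path_image \<gamma> \<subseteq> X"
    "\<And>i. i \<in> {1..n} \<Longrightarrow> \<gamma> ` {t (i - 1)..t i} \<subseteq> U i"
    "\<And>i. i \<in> {0..n} \<Longrightarrow> \<gamma> (t i) = g (t i)" "homotopic_paths X \<gamma> f"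
proof -
  have "\<exists>\<gamma>. path \<gamma> \<and> path_image \<gamma> \<subseteq> X \<and> (\<forall>i\<in>{1..n}. \<gamma> ` {t (i - 1)..t i} \<subseteq> U i) \<and>
      (\<forall>i\<in>{0..n}. \<gamma> (t i) = g (t i)) \<and> homotopic_paths X \<gamma> f"
    using assms(1)[unfolded homotopically_close_def, THEN conjunct2, THEN conjunct2,
        THEN conjunct2, THEN conjunct2, THEN conjunct2, THEN conjunct2,
        rule_format, of t n U] assms(2-) by simp
  then show thesis
    by (elim exE conjE) (rule that, simp_all)
qed

lemma partition_mono:
  fixes t :: "nat \<Rightarrow> real"
  assumes "\<And>i. i \<in> {1..n} \<Longrightarrow> t (i - 1) < t i" and "i \<le> j" "j \<le> n"
  shows "t i \<le> t j"
  using assms(2,3)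
proof (induction j rule: dec_induct)
  case (step k)
  then show ?case
    using assms(1)[of "Suc k"] by simp
qed simp

text \<open>
  The part of a partition of \<open>[0,1]\<close> that lies before \<open>1/2\<close>, stretched by the factor two, is a
  partition for \<open>g\<close> once it is closed off with the point \<open>1\<close>.  The last interval of this new
  partition belongs to the interval that contains \<open>1/2\<close>, so the first few of the given open sets
  serve for it, and no refinement at \<open>1/2\<close> is needed.
\<close>

lemma homotopically_close_join_right:
  fixes X :: "'a::topological_space set"
  assumes fg: "homotopically_close X f g"
    and k: "path k" "path_image k \<subseteq> X" "pathstart k = pathfinish g"
  shows "homotopically_close X (f +++ k) (g +++ k)"
  unfolding homotopically_close_def
proof (intro conjI allI impI)
  have paths: "path f" "path_image f \<subseteq> X" "path g" "path_image g \<subseteq> X"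
    "pathstart f = pathstart g" "pathfinish f = pathfinish g"
    using fg by (auto simp: homotopically_close_def)
  show "path (f +++ k)" "path_image (f +++ k) \<subseteq> X" "path (g +++ k)" "path_image (g +++ k) \<subseteq> X"
    "pathstart (f +++ k) = pathstart (g +++ k)" "pathfinish (f +++ k) = pathfinish (g +++ k)"
    using paths k by (auto simp: path_image_join)
  fix n :: nat and t :: "nat \<Rightarrow> real" and U :: "nat \<Rightarrow> 'a set"
  assume part: "t 0 = 0 \<and> t n = 1 \<and> (\<forall>i\<in>{1..n}. t (i - 1) < t i) \<and>
      (\<forall>i\<in>{1..n}. openin (top_of_set X) (U i) \<and> (g +++ k) ` {t (i - 1)..t i} \<subseteq> U i)"
  then have incr: "\<And>i. i \<in> {1..n} \<Longrightarrow> t (i - 1) < t i"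
    and gk: "\<And>i r. i \<in> {1..n} \<Longrightarrow> r \<in> {t (i - 1)..t i} \<Longrightarrow> (g +++ k) r \<in> U i"
    by blast+
  have mono: "t i \<le> t j" if "i \<le> j" "j \<le> n" for i j
    using incr that by (rule partition_mono)
  define m where "m = (LEAST i. 1/2 \<le> t i)"
  have half: "1/2 \<le> t n"
    using part by simp
  have tm: "1/2 \<le> t m" and mn: "m \<le> n"
    unfolding m_def using half by (rule LeastI, rule Least_le)
  have below: "t i < 1/2" if "i < m" for i
    using not_less_Least[OF that[unfolded m_def]] by simp
  define s where "s i = (if i < m then 2 * t i else 1)" for i
  have "m \<noteq> 0"
    using tm part by (intro notI) simp
  have s_incr: "s (i - 1) < s i" if "i \<in> {1..m}" for i
    using incr[of i] below[of "i - 1"] that mn by (auto simp: s_def)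
  have s_ends: "s 0 = 0" "s m = 1"
    using \<open>m \<noteq> 0\<close> part by (auto simp: s_def)
  have opens: "openin (top_of_set X) (U i)" if "i \<in> {1..m}" for i
    using that part mn by auto
  have g_in: "g ` {s (i - 1)..s i} \<subseteq> U i" if i: "i \<in> {1..m}" for i
  proof (rule image_subsetI)
    fix r assume r: "r \<in> {s (i - 1)..s i}"
    have "i - 1 < m"
      using i by auto
    moreover have "s i \<le> 2 * t i" "s i \<le> 1"
      using tm below[of i] i by (cases "i = m"; force simp: s_def)+
    ultimately have "r / 2 \<in> {t (i - 1)..t i}" "r / 2 \<le> 1/2"
      using r by (auto simp: s_def)
    then show "g r \<in> U i"
      using gk[of i "r / 2"] i mn by (simp add: joinpaths_def)
  qed
  obtain \<gamma> where \<gamma>: "path \<gamma>" "path_image \<gamma> \<subseteq> X"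
    "\<And>i. i \<in> {1..m} \<Longrightarrow> \<gamma> ` {s (i - 1)..s i} \<subseteq> U i"
    "\<And>i. i \<in> {0..m} \<Longrightarrow> \<gamma> (s i) = g (s i)" "homotopic_paths X \<gamma> f"
    by (rule homotopically_closeD[of X f g s m U, OF fg s_ends s_incr opens g_in], assumption+, rule that)
  have \<gamma>_finish: "pathfinish \<gamma> = pathfinish g"
    using \<gamma>(5) paths by (simp add: homotopic_paths_imp_pathfinish)
  show "\<exists>\<gamma>. path \<gamma> \<and> path_image \<gamma> \<subseteq> X \<and>
      (\<forall>i\<in>{1..n}. \<gamma> ` {t (i - 1)..t i} \<subseteq> U i) \<and>
      (\<forall>i\<in>{0..n}. \<gamma> (t i) = (g +++ k) (t i)) \<and> homotopic_paths X \<gamma> (f +++ k)"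
  proof (intro exI[of _ "\<gamma> +++ k"] conjI ballI image_subsetI)
    show "path (\<gamma> +++ k)" "path_image (\<gamma> +++ k) \<subseteq> X"
      using \<gamma> k \<gamma>_finish by (auto simp: path_image_join)
    show "homotopic_paths X (\<gamma> +++ k) (f +++ k)"
      using \<gamma> k \<gamma>_finish by (intro homotopic_paths_join) auto
  next
    fix i assume i: "i \<in> {0..n}"
    show "(\<gamma> +++ k) (t i) = (g +++ k) (t i)"
    proof (cases "t i \<le> 1/2")
      case True
      have "i \<le> m"
      proof (rule ccontr)
        assume "\<not> i \<le> m"
        then have "t m \<le> t (i - 1)" "t (i - 1) < t i"
          using mono[of m "i - 1"] incr[of i] i by auto
        then show False
          using tm True by simp
      qed
      moreover have "s i = 2 * t i"
        using True tm \<open>i \<le> m\<close> by (cases "i = m") (auto simp: s_def)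
      ultimately show ?thesis
        using \<gamma>(4)[of i] True by (simp add: joinpaths_def)
    qed (simp add: joinpaths_def)
  next
    fix i r assume i: "i \<in> {1..n}" and r: "r \<in> {t (i - 1)..t i}"
    consider "r > 1/2" | "r \<le> 1/2" "i \<le> m" | "r \<le> 1/2" "m < i"
      by linarith
    then show "(\<gamma> +++ k) r \<in> U i"
    proof cases
      case 1
      then show ?thesis
        using gk[OF i r] by (simp add: joinpaths_def)
    next
      case 2
      then have "2 * r \<in> {s (i - 1)..s i}"
        using r i by (auto simp: s_def)
      then have "\<gamma> (2 * r) \<in> U i"
        using \<gamma>(3)[of i] 2 i by auto
      then show ?thesis
        using 2 by (simp add: joinpaths_def)
    next
      \<comment> \<open>Only \<open>r = 1/2 = t m\<close> is possible here, and there both paths agree.\<close>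
      case 3
      then have "t m \<le> t (i - 1)"
        using mono[of m "i - 1"] i by auto
      then have "r = 1/2"
        using 3 r tm by simp
      moreover have "(\<gamma> +++ k) (1/2) = (g +++ k) (1/2)"
        using \<gamma>_finish by (simp add: joinpaths_def pathfinish_def)
      ultimately show ?thesis
        using gk[OF i r] by metis
    qed
  qed
qed

lemma homotopically_close_reversepath:
  fixes X :: "'a::topological_space set"
  assumes fg: "homotopically_close X f g"
  shows "homotopically_close X (reversepath f) (reversepath g)"
  unfolding homotopically_close_def
proof (intro conjI allI impI)
  show "path (reversepath f)" "path_image (reversepath f) \<subseteq> X"
    "path (reversepath g)" "path_image (reversepath g) \<subseteq> X"
    "pathstart (reversepath f) = pathstart (reversepath g)"
    "pathfinish (reversepath f) = pathfinish (reversepath g)"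
    using fg by (auto simp: homotopically_close_def)
  fix n :: nat and t :: "nat \<Rightarrow> real" and U :: "nat \<Rightarrow> 'a set"
  assume part: "t 0 = 0 \<and> t n = 1 \<and> (\<forall>i\<in>{1..n}. t (i - 1) < t i) \<and>
      (\<forall>i\<in>{1..n}. openin (top_of_set X) (U i) \<and> reversepath g ` {t (i - 1)..t i} \<subseteq> U i)"
  then have incr: "\<And>i. i \<in> {1..n} \<Longrightarrow> t (i - 1) < t i"
    and U_open: "\<And>i. i \<in> {1..n} \<Longrightarrow> openin (top_of_set X) (U i)"
    and rg: "\<And>i r. i \<in> {1..n} \<Longrightarrow> r \<in> {t (i - 1)..t i} \<Longrightarrow> reversepath g r \<in> U i"
    by blast+
  define s where "s i = 1 - t (n - i)" for i
  \<comment> \<open>The reflection of \<open>[0,1]\<close> exchanges the intervals with indices \<open>i\<close> and \<open>n + 1 - i\<close>.\<close>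
  have swap: "n + 1 - i \<in> {1..n}" "n + 1 - (n + 1 - i) = i"
    "s (i - 1) = 1 - t (n + 1 - i)" "s i = 1 - t (n + 1 - i - 1)" if "i \<in> {1..n}" for i
    using that by (auto simp: s_def)
  have s_ends: "s 0 = 0" "s n = 1"
    using part by (auto simp: s_def)
  have s_incr: "s (i - 1) < s i" and opens: "openin (top_of_set X) (U (n + 1 - i))"
    if "i \<in> {1..n}" for i
    using incr[OF swap(1)[OF that]] U_open[OF swap(1)[OF that]] swap(3,4)[OF that] by simp_all
  have g_in: "g ` {s (i - 1)..s i} \<subseteq> U (n + 1 - i)" if i: "i \<in> {1..n}" for i
  proof (rule image_subsetI)
    fix r assume "r \<in> {s (i - 1)..s i}"
    then have "1 - r \<in> {t (n + 1 - i - 1)..t (n + 1 - i)}"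
      using swap(3,4)[OF i] by auto
    then have "reversepath g (1 - r) \<in> U (n + 1 - i)"
      using rg[OF swap(1)[OF i]] by blast
    then show "g r \<in> U (n + 1 - i)"
      by (simp add: reversepath_def)
  qed
  obtain \<gamma> where \<gamma>: "path \<gamma>" "path_image \<gamma> \<subseteq> X"
    "\<And>i. i \<in> {1..n} \<Longrightarrow> \<gamma> ` {s (i - 1)..s i} \<subseteq> U (n + 1 - i)"
    "\<And>i. i \<in> {0..n} \<Longrightarrow> \<gamma> (s i) = g (s i)" "homotopic_paths X \<gamma> f"
    by (rule homotopically_closeD[of X f g s n "\<lambda>i. U (n + 1 - i)",
          OF fg s_ends s_incr opens g_in], assumption+, rule that)
  show "\<exists>\<gamma>. path \<gamma> \<and> path_image \<gamma> \<subseteq> X \<and>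
      (\<forall>i\<in>{1..n}. \<gamma> ` {t (i - 1)..t i} \<subseteq> U i) \<and>
      (\<forall>i\<in>{0..n}. \<gamma> (t i) = reversepath g (t i)) \<and> homotopic_paths X \<gamma> (reversepath f)"
  proof (intro exI[of _ "reversepath \<gamma>"] conjI ballI image_subsetI)
    show "path (reversepath \<gamma>)" "path_image (reversepath \<gamma>) \<subseteq> X"
      using \<gamma> by auto
    show "homotopic_paths X (reversepath \<gamma>) (reversepath f)"
      using \<gamma>(5) by (simp add: homotopic_paths_reversepath)
  next
    fix i assume "i \<in> {0..n}"
    then show "reversepath \<gamma> (t i) = reversepath g (t i)"
      using \<gamma>(4)[of "n - i"] by (simp add: s_def reversepath_def)
  next
    fix i r assume i: "i \<in> {1..n}" and r: "r \<in> {t (i - 1)..t i}"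
    define j where "j = n + 1 - i"
    have j: "j \<in> {1..n}" "n + 1 - j = i"
      using swap(1,2)[OF i] by (auto simp: j_def)
    have "1 - r \<in> {s (j - 1)..s j}"
      using r swap(3,4)[OF j(1)] j(2) by auto
    then have "\<gamma> (1 - r) \<in> U i"
      using \<gamma>(3)[OF j(1)] j(2) by auto
    then show "reversepath \<gamma> r \<in> U i"
      by (simp add: reversepath_def)
  qed
qed

lemma homotopically_close_join_left:
  assumes fg: "homotopically_close X f g"
    and k: "path k" "path_image k \<subseteq> X" "pathfinish k = pathstart g"
  shows "homotopically_close X (k +++ f) (k +++ g)"
proof -
  have "pathstart f = pathstart g"
    using fg by (simp add: homotopically_close_def)
  moreover have "homotopically_close X (reversepath (reversepath f +++ reversepath k))
      (reversepath (reversepath g +++ reversepath k))"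
    using k by (intro homotopically_close_reversepath homotopically_close_join_right fg) auto
  ultimately show ?thesis
    using k by (simp add: reversepath_joinpaths)
qed

lemma homotopic_paths_reversepath_right:
  assumes "path p" "path_image p \<subseteq> X" "pathstart p = x"
  shows "homotopic_paths X (p +++ reversepath p) (\<lambda>_. x)"
  using homotopic_paths_reversepath_left[of "reversepath p" X x] assms by simp

lemma path_class_eqI: "homotopic_paths X f g \<Longrightarrow> path_class X f = path_class X g"
  by (metis path_class_eq_iff homotopic_paths_imp_path homotopic_paths_imp_subset)

lemma in_pi1_qs_iff:
  assumes "x \<in> X"
  shows "A \<in> pi1_qs X x \<longleftrightarrow> (\<exists>f c. A = path_class X f \<and> loop_at X x f \<and> loop_at X x c \<and>
    homotopic_paths X c (\<lambda>_. x) \<and> homotopically_close X f c)"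
proof -
  have "path_class X c = path_class X (\<lambda>_. x) \<longleftrightarrow> homotopic_paths X c (\<lambda>_. x)"
    if "loop_at X x c" for c
    using that by (simp add: path_class_eq_iff loop_at_def)
  then show ?thesis
    unfolding pi1_qs_def pi_qs_def by blast
qed

lemma close_imp_join_reversepath_in_pi1_qs:
  assumes "homotopically_close X f g" "pathstart g = x"
  shows "path_class X (f +++ reversepath g) \<in> pi1_qs X x"
proof -
  have paths: "path f" "path_image f \<subseteq> X" "path g" "path_image g \<subseteq> X"
    "pathstart f = x" "pathfinish f = pathfinish g"
    using assms by (auto simp: homotopically_close_def)
  then have "x \<in> X"
    using pathstart_in_path_image by blast
  have "loop_at X x (f +++ reversepath g)" "loop_at X x (g +++ reversepath g)"
    using paths assms(2) by (auto simp: loop_at_def path_image_join)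
  moreover have "homotopic_paths X (g +++ reversepath g) (\<lambda>_. x)"
    using paths assms(2) by (intro homotopic_paths_reversepath_right)
  moreover have "homotopically_close X (f +++ reversepath g) (g +++ reversepath g)"
    using assms paths by (intro homotopically_close_join_right) auto
  ultimately show ?thesis
    using in_pi1_qs_iff[OF \<open>x \<in> X\<close>] by blast
qed

text \<open>
  Translation by a loop \<open>h\<close> with class in \<open>H\<close> turns closeness to a null-homotopic loop into
  closeness to a loop with class in \<open>H\<close>, and translation by \<open>reversepath h\<close> turns closeness to \<open>h\<close>
  into closeness to a null-homotopic loop.  These are the two inclusions.
\<close>

lemma pi_qs_eq_set_mult:
  assumes x: "x \<in> X" and H: "H \<subseteq> carrier (fundamental_group X x)"
  shows "pi_qs X x H = H <#>\<^bsub>fundamental_group X x\<^esub> pi1_qs X x"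
proof (intro equalityI subsetI)
  let ?G = "fundamental_group X x"
  fix A assume "A \<in> pi_qs X x H"
  then obtain f h where A: "A = path_class X f" and f: "loop_at X x f" and h: "loop_at X x h"
    and hH: "path_class X h \<in> H" and close: "homotopically_close X f h"
    by (auto simp: pi_qs_def)
  let ?r = "reversepath h"
  have loops: "loop_at X x (?r +++ f)" "loop_at X x (?r +++ h)"
    using f h by (auto intro: loop_at_join loop_at_reversepath)
  have "homotopic_paths X (?r +++ h) (\<lambda>_. x)"
    using h by (intro homotopic_paths_reversepath_left) (auto simp: loop_at_def)
  moreover have "homotopically_close X (?r +++ f) (?r +++ h)"
    using close h by (intro homotopically_close_join_left) (auto simp: loop_at_def)
  ultimately have "path_class X (?r +++ f) \<in> pi1_qs X x"
    using in_pi1_qs_iff[OF x] loops by blast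
  moreover have "A = path_class X h \<otimes>\<^bsub>?G\<^esub> path_class X (?r +++ f)"
  proof -
    have "homotopic_paths X (h +++ ?r +++ f) ((h +++ ?r) +++ f)"
      using f h by (intro homotopic_paths_assoc) (auto simp: loop_at_def)
    also have "homotopic_paths X ((h +++ ?r) +++ f) ((\<lambda>_. x) +++ f)"
      using f h by (intro homotopic_paths_join homotopic_paths_reversepath_right)
        (auto simp: loop_at_def)
    also have "homotopic_paths X ((\<lambda>_. x) +++ f) f"
      using f by (intro homotopic_paths_const_left) (auto simp: loop_at_def)
    finally show ?thesis
      using A h loops by (simp add: mult_fundamental_group path_class_eqI)
  qed
  ultimately show "A \<in> H <#>\<^bsub>?G\<^esub> pi1_qs X x"
    using hH by (auto simp: set_mult_def)
next
  let ?G = "fundamental_group X x"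
  fix A assume "A \<in> H <#>\<^bsub>?G\<^esub> pi1_qs X x"
  then obtain B f c where B: "B \<in> H" and A: "A = B \<otimes>\<^bsub>?G\<^esub> path_class X f"
    and f: "loop_at X x f" and c: "loop_at X x c" and null: "homotopic_paths X c (\<lambda>_. x)"
    and close: "homotopically_close X f c"
    by (auto simp: set_mult_def in_pi1_qs_iff[OF x])
  obtain h where h: "loop_at X x h" and Bh: "B = path_class X h"
    using H B by (auto simp: fundamental_group_def)
  interpret G: group ?G
    using x by (rule group_fundamental_group)
  have "path_class X (h +++ c) = B \<otimes>\<^bsub>?G\<^esub> path_class X c"
    using h c Bh by (simp add: mult_fundamental_group)
  also have "path_class X c = \<one>\<^bsub>?G\<^esub>"
    using null by (simp add: path_class_eqI fundamental_group_def)
  also have "B \<otimes>\<^bsub>?G\<^esub> \<one>\<^bsub>?G\<^esub> = B"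
    using B H by auto
  finally have "path_class X (h +++ c) \<in> H"
    using B by simp
  moreover have "homotopically_close X (h +++ f) (h +++ c)"
    using close h c by (intro homotopically_close_join_left) (auto simp: loop_at_def)
  moreover have "A = path_class X (h +++ f)"
    using A Bh h f by (simp add: mult_fundamental_group)
  ultimately show "A \<in> pi_qs X x H"
    using loop_at_join[OF h f] loop_at_join[OF h c] unfolding pi_qs_def by blast
qed

theorem proposition3p3:
  fixes X :: "'a::topological_space set" and x :: 'a
  assumes "path_connected X" and "x \<in> X"
  shows "(\<forall>f g. path f \<and> path_image f \<subseteq> X \<and> path g \<and> path_image g \<subseteq> X \<and>
              pathstart f = x \<and> pathstart g = x \<and> pathfinish f = pathfinish g \<and>
              homotopically_close X f g
            \<longrightarrow> path_class X (f +++ reversepath g) \<in> pi1_qs X x) \<and>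
         (\<forall>H. subgroup H (fundamental_group X x)
            \<longrightarrow> pi_qs X x H = H <#>\<^bsub>fundamental_group X x\<^esub> pi1_qs X x)"
  using close_imp_join_reversepath_in_pi1_qs pi_qs_eq_set_mult[OF assms(2)] subgroup.subset
  by blast

end
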